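(* Let $\xi_1,\xi_2,\dots$ be samples from a stochastic process converging to $\mathbb{P}$ whose $\phi$-mixing coefficients satisfy $\sum_{k=1}^\infty\phi(k)<\infty$, and suppose that $\ell(x;\xi)$ is bounded by a constant $L$ for all $x\in\mathbb{X}$ and $\xi\in\Xi$. For each $K\ge1$ let $\widehat{J}^*_K$ and $\widehat{x}^*_K$ be the optimal value and optimal solution of $\min_{x\in\mathbb{X}}\frac1K\sum_{k=1}^K\ell(x;\xi_k)$, and let $J^*$ and $x^*$ be the optimal value and the optimal solution of $\min_{x\in\mathbb{X}}\mathbb{E}^{\mathbb{P}}[\ell(x;\xi)]$. For $\beta\in(0,1)$ put $$\varepsilon_K(\beta)=\left(\frac{2\,C\!\left(\sum_{k=1}^{K}\phi(k)\right)\log(2\beta^{-1})}{K^2}\right)^{1/2}.$$ Let $\beta_K\in(0,1)$ be a sequence with $\lim_{K\to\infty}\varepsilon_K(\beta_K)=0$ and $\sum_{K=1}^\infty\beta_K<\infty$. Then $$\Pr\left\{\lim_{K\to\infty}\widehat{J}^*_K=J^*\right\}=1\quad\text{and}\quad \Pr\left\{\lim_{K\to\infty}\widehat{x}^*_K=x^*\right\}=1 .$$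
   Context: Setting. $\Xi$ is a sample space with probability distribution $\mathbb{P}$, $\mathbb{X}\subset\mathbb{R}^d$ is a convex feasible parameter set, and $\ell(x;\xi)$ is a loss function that is closed, convex and proper (in $x$). The distribution $\mathbb{P}$ is observed only through samples $\xi_1,\xi_2,\dots$ from an ergodic stochastic process converging to the stationary distribution $\mathbb{P}$; the samples need not be independent. The empirical distribution is $\widehat{\mathbb{P}}_K=\frac1K\sum_{k=1}^K\delta_{\xi_k}$. Mixing. The total variation distance is $d_{\mathrm{TV}}(\mathbb{P},\mathbb{Q})=\sup_{A\subset\Xi}|\mathbb{P}(A)-\mathbb{Q}(A)|$ (supremum over measurable $A$). With $\mathcal{F}_0=\{\emptyset,\Omega\}$ and $\mathcal{F}_k=\sigma(\xi_1,\dots,\xi_k)$, the $\phi$-mixing coefficients are $\phi(l)=\sup_{k\in\mathbb{N}^+,\,B\in\mathcal{F}_k}\{2\,d_{\mathrm{TV}}(P^{k+l}(\cdot\mid B),\mathbb{P})\}$, where $P^{k+l}(\cdot\mid B)$ is the conditional distribution of $\xi_{k+l}$ given $B$. The quantity $C(\cdot)$. Write $\|\widehat{\mathbb{P}}_K-\mathbb{P}\|=\int_0^1|\widehat{\mathbb{P}}_K(t)-\mathbb{P}(t)|\,\mathrm{d}t$, where $\widehat{\mathbb{P}}_K(t),\mathbb{P}(t)$ are the distribution functions. $C(\sum_{k=1}^K\phi(k))<\infty$ denotes the quantity, depending only on $\sum_{k=1}^K\phi(k)$, in the known concentration inequality (Dedecker and Merlevède), valid when $\sum_{k}\phi(k)<\infty$: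 for all $K\ge1$ and $\varepsilon>0$, $\Pr\{\|\widehat{\mathbb{P}}_K-\mathbb{P}\|\ge\varepsilon\}\le 2\exp\left(-\frac{K^2\varepsilon^2}{2C(\sum_{k=1}^K\phi(k))}\right)$.
   Formalization: The loss is taken closed as a function with domain X, so with the bound L the convex feasible set X is closed; for a merely convex, non-closed X the convergence of the optimal solutions can fail. *)

theory Defs
  imports "HOL-Probability.Probability"
begin

(* f is a real-valued function with effective domain X: properness amounts to X being nonempty,
   and closedness is closedness of the epigraph over X.  In particular, if f is bounded above
   on X, then X is closed. *)
definition closed_convex_proper_on :: "'a::euclidean_space set \<Rightarrow> ('a \<Rightarrow> real) \<Rightarrow> bool" where
  "closed_convex_proper_on X f \<longleftrightarrow> X \<noteq> {} \<and> convex_on X f \<and> closed (epigraph X f)"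

definition tv_dist :: "'b measure \<Rightarrow> 'b measure \<Rightarrow> real" where
  "tv_dist P Q = (SUP A\<in>sets P. \<bar>measure P A - measure Q A\<bar>)"

(* The sigma-algebra generated by \<xi> 1, ..., \<xi> k on the space of M; for k = 0 it is
   the trivial one. *)
definition past_events ::
  "'w measure \<Rightarrow> 'b measure \<Rightarrow> (nat \<Rightarrow> 'w \<Rightarrow> 'b) \<Rightarrow> nat \<Rightarrow> 'w set set" where
  "past_events M P \<xi> k =
     sigma_sets (space M) {\<xi> i -` A \<inter> space M | i A. i \<in> {1..k} \<and> A \<in> sets P}"

(* uniform_measure M B is M conditioned on the event B. *)
definition cond_law ::
  "'w measure \<Rightarrow> 'b measure \<Rightarrow> (nat \<Rightarrow> 'w \<Rightarrow> 'b) \<Rightarrow> nat \<Rightarrow> 'w set \<Rightarrow> 'b measure" where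
  "cond_law M P \<xi> n B = distr (uniform_measure M B) P (\<xi> n)"

(* The supremum ranges over events of positive probability, for which the conditional
   distribution is defined.  It is over a nonempty set of reals bounded by 2. *)
definition phi_mixing ::
  "'w measure \<Rightarrow> 'b measure \<Rightarrow> (nat \<Rightarrow> 'w \<Rightarrow> 'b) \<Rightarrow> nat \<Rightarrow> real" where
  "phi_mixing M P \<xi> l =
     (SUP (k, B) \<in> {(k, B). 1 \<le> k \<and> B \<in> past_events M P \<xi> k \<and> measure M B > 0}.
        2 * tv_dist (cond_law M P \<xi> (k + l) B) P)"

(* Law of \<xi> J \<omega> for J uniform on {1..K}, that is, (1/K) times the sum of the unit
   masses at \<xi> 1 \<omega>, ..., \<xi> K \<omega>; used for K \<ge> 1 only. *)
definition empirical_dist ::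
  "'b measure \<Rightarrow> (nat \<Rightarrow> 'w \<Rightarrow> 'b) \<Rightarrow> nat \<Rightarrow> 'w \<Rightarrow> 'b measure" where
  "empirical_dist P \<xi> K \<omega> = distr (uniform_count_measure {1..K}) P (\<lambda>k. \<xi> k \<omega>)"

(* The library's cdf is for measures on the whole real line; Q may live on a subset. *)
definition dist_fun :: "real measure \<Rightarrow> real \<Rightarrow> real" where
  "dist_fun Q = cdf (distr Q borel (\<lambda>s. s))"

definition df_dist :: "real measure \<Rightarrow> real measure \<Rightarrow> real" where
  "df_dist Q P = (LINT t:{0..1}|lborel. \<bar>dist_fun Q t - dist_fun P t\<bar>)"

definition df_concentration ::
  "'w measure \<Rightarrow> real measure \<Rightarrow> (nat \<Rightarrow> 'w \<Rightarrow> real) \<Rightarrow> (real \<Rightarrow> real) \<Rightarrow> bool" where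
  "df_concentration M P \<xi> C \<longleftrightarrow>
     (\<forall>K\<ge>1. \<forall>\<epsilon>>0.
        measure M {\<omega>\<in>space M. df_dist (empirical_dist P \<xi> K \<omega>) P \<ge> \<epsilon>}
          \<le> 2 * exp (- ((real K)\<^sup>2 * \<epsilon>\<^sup>2) / (2 * C (\<Sum>k=1..K. phi_mixing M P \<xi> k))))"

definition eps_radius ::
  "'w measure \<Rightarrow> real measure \<Rightarrow> (nat \<Rightarrow> 'w \<Rightarrow> real) \<Rightarrow> (real \<Rightarrow> real) \<Rightarrow> nat \<Rightarrow> real \<Rightarrow> real" where
  "eps_radius M P \<xi> C K b =
     sqrt (2 * C (\<Sum>k=1..K. phi_mixing M P \<xi> k) * ln (2 * inverse b) / (real K)\<^sup>2)"

definition emp_objective ::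
  "('a \<Rightarrow> 'b \<Rightarrow> real) \<Rightarrow> (nat \<Rightarrow> 'w \<Rightarrow> 'b) \<Rightarrow> nat \<Rightarrow> 'w \<Rightarrow> 'a \<Rightarrow> real" where
  "emp_objective loss \<xi> K \<omega> x = (1 / real K) * (\<Sum>k=1..K. loss x (\<xi> k \<omega>))"

definition true_objective :: "('a \<Rightarrow> 'b \<Rightarrow> real) \<Rightarrow> 'b measure \<Rightarrow> 'a \<Rightarrow> real" where
  "true_objective loss P x = (\<integral>s. loss x s \<partial>P)"

definition optimal_value :: "('a \<Rightarrow> real) \<Rightarrow> 'a set \<Rightarrow> real" where
  "optimal_value f X = (INF x\<in>X. f x)"

definition optimal_solution :: "('a \<Rightarrow> real) \<Rightarrow> 'a set \<Rightarrow> 'a \<Rightarrow> bool" where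
  "optimal_solution f X x \<longleftrightarrow> is_arg_min f (\<lambda>y. y \<in> X) x"

end

theory Submission
  imports Defs "HOL-Library.Discrete_Functions"
begin

text \<open>Summability of the mixing coefficients makes the events \<open>\<xi> k \<in> A\<close> so weakly
  correlated that the variance of their number up to time \<open>K\<close> is \<open>O(K)\<close>; convergence of frequencies
  along the squares follows, and boundedness of the increments fills the gaps.  Uniform approximation by
  step functions yields the strong law for bounded measurable functions.  Applied to the countably
  many infima of the loss over balls with centres in a countable dense subset of \<open>X\<close>, it gives
  almost surely, by lower semicontinuity, an eventual uniform lower bound of the empirical
  objectives on each compact set.  On small spheres around \<open>xstar\<close> this bound exceeds the
  empirical objective at \<open>xstar\<close>, and convexity then traps the empirical minimisers inside.\<close>

section \<open>A strong law for mixing samples\<close>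

text \<open>With \<open>m = floor_sqrt n\<close>, at most \<open>2 * m\<close> indices lie between
  \<open>m\<^sup>2\<close> and \<open>n\<close>. Terms bounded by 1 then change the partial sum by
  at most \<open>2 * m\<close>, which is negligible against \<open>m\<^sup>2\<close>.\<close>

lemma averages_tendsto_0_from_squares:
  fixes y :: "nat \<Rightarrow> real"
  assumes bd: "\<And>k. \<bar>y k\<bar> \<le> 1"
    and sq: "(\<lambda>n. (\<Sum>k<n\<^sup>2. y k) / real (n\<^sup>2)) \<longlonglongrightarrow> 0"
  shows "(\<lambda>n. (\<Sum>k<n. y k) / real n) \<longlonglongrightarrow> 0"
proof -
  define S where "S n = (\<Sum>k<n. y k)" for n
  have fs: "filterlim floor_sqrt at_top sequentially"
    unfolding filterlim_at_top
  proof
    fix Z :: nat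
    show "\<forall>\<^sub>F n in sequentially. Z \<le> floor_sqrt n"
      using eventually_ge_at_top[of "Z\<^sup>2"]
      by eventually_elim (simp add: le_floor_sqrt_iff)
  qed
  have A: "(\<lambda>n. \<bar>S ((floor_sqrt n)\<^sup>2) / real ((floor_sqrt n)\<^sup>2)\<bar> + 2 / real (floor_sqrt n)) \<longlonglongrightarrow> 0 + 0"
  proof (intro tendsto_add tendsto_rabs_zero)
    show "(\<lambda>n. S ((floor_sqrt n)\<^sup>2) / real ((floor_sqrt n)\<^sup>2)) \<longlonglongrightarrow> 0"
      using filterlim_compose[OF sq fs] by (simp add: S_def)
    have "(\<lambda>n. 2 / real n) \<longlonglongrightarrow> 0"
      by (rule lim_const_over_n)
    then show "(\<lambda>n. 2 / real (floor_sqrt n)) \<longlonglongrightarrow> 0"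
      using filterlim_compose[OF _ fs] by blast
  qed
  have B: "\<forall>\<^sub>F n in sequentially. norm (S n / real n)
      \<le> \<bar>S ((floor_sqrt n)\<^sup>2) / real ((floor_sqrt n)\<^sup>2)\<bar> + 2 / real (floor_sqrt n)"
    using eventually_gt_at_top[of 0]
  proof eventually_elim
    case (elim n)
    define m where "m = floor_sqrt n"
    have m: "m > 0" "m\<^sup>2 \<le> n" using elim by (auto simp: m_def)
    have "n < (Suc m)\<^sup>2" by (simp add: m_def Suc_floor_sqrt_power2_gt)
    then have n: "n - m\<^sup>2 \<le> 2 * m" by (simp add: power2_eq_square)
    have "S n = S (m\<^sup>2) + (\<Sum>k\<in>{m\<^sup>2..<n}. y k)"
      unfolding S_def using m by (metis lessThan_atLeast0 sum.atLeastLessThan_concat zero_le)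
    moreover have "\<bar>\<Sum>k\<in>{m\<^sup>2..<n}. y k\<bar> \<le> real (n - m\<^sup>2)"
      using sum_norm_bound[of "{m\<^sup>2..<n}" y 1] bd by simp
    ultimately have "\<bar>S n\<bar> \<le> \<bar>S (m\<^sup>2)\<bar> + 2 * real m"
      using n by linarith
    then have "\<bar>S n\<bar> / real n \<le> (\<bar>S (m\<^sup>2)\<bar> + 2 * real m) / real (m\<^sup>2)"
      using m elim by (intro frac_le) auto
    also have "\<dots> = \<bar>S (m\<^sup>2) / real (m\<^sup>2)\<bar> + 2 / real m"
      using m by (simp add: field_simps power2_eq_square)
    finally show ?case by (simp add: m_def)
  qed
  show ?thesis
    using Lim_null_comparison[OF B] A unfolding S_def by simp
qed

text \<open>Here \<open>\<phi> l\<close> controls the correlation at lag \<open>Suc l\<close>.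
  Adding \<open>Y n\<close> to the sum contributes a square of mean at most 1 and twice the
  correlations with all earlier terms. Their lags are distinct, so the whole series
  \<open>suminf \<phi>\<close> bounds them independently of \<open>n\<close>.\<close>

lemma (in prob_space) second_moment_sum_le:
  fixes Y :: "nat \<Rightarrow> 'a \<Rightarrow> real"
  assumes meas [measurable]: "\<And>k. Y k \<in> borel_measurable M"
    and bd: "\<And>k \<omega>. \<bar>Y k \<omega>\<bar> \<le> 1"
    and corr: "\<And>j l. \<bar>expectation (\<lambda>\<omega>. Y j \<omega> * Y (Suc (j + l)) \<omega>)\<bar> \<le> \<phi> l"
    and summ: "summable \<phi>"
  shows "expectation (\<lambda>\<omega>. (\<Sum>k<n. Y k \<omega>)\<^sup>2) \<le> real n * (1 + 2 * suminf \<phi>)"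
proof (induction n)
  case 0
  then show ?case by simp
next
  case (Suc n)
  have nn: "\<phi> l \<ge> 0" for l
    using corr[of 0 l] by linarith
  have int2: "integrable M (\<lambda>\<omega>. Y j \<omega> * Y k \<omega>)" for j k
    by (rule integrable_const_bound[where B = 1])
       (auto simp: abs_mult intro!: mult_le_one bd)
  have int_sq: "integrable M (\<lambda>\<omega>. (\<Sum>k<n. Y k \<omega>)\<^sup>2)"
    unfolding power2_eq_square sum_product by (intro Bochner_Integration.integrable_sum int2)
  have "(\<Sum>k<Suc n. Y k \<omega>)\<^sup>2
      = (\<Sum>k<n. Y k \<omega>)\<^sup>2 + 2 * (\<Sum>k<n. Y k \<omega> * Y n \<omega>) + Y n \<omega> * Y n \<omega>" for \<omega>
    by (simp add: sum_distrib_right[symmetric] power2_eq_square algebra_simps)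
  then have "expectation (\<lambda>\<omega>. (\<Sum>k<Suc n. Y k \<omega>)\<^sup>2)
      = expectation (\<lambda>\<omega>. (\<Sum>k<n. Y k \<omega>)\<^sup>2)
        + 2 * (\<Sum>k<n. expectation (\<lambda>\<omega>. Y k \<omega> * Y n \<omega>)) + expectation (\<lambda>\<omega>. Y n \<omega> * Y n \<omega>)"
    using int_sq int2 by simp
  moreover have "(\<Sum>k<n. expectation (\<lambda>\<omega>. Y k \<omega> * Y n \<omega>)) \<le> (\<Sum>k<n. \<phi> (n - Suc k))"
  proof (intro sum_mono)
    fix k assume "k \<in> {..<n}"
    then have "Suc (k + (n - Suc k)) = n" by auto
    then show "expectation (\<lambda>\<omega>. Y k \<omega> * Y n \<omega>) \<le> \<phi> (n - Suc k)"
      using corr[of k "n - Suc k"] by simp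
  qed
  moreover have "(\<Sum>k<n. \<phi> (n - Suc k)) \<le> suminf \<phi>"
    using sum_le_suminf[OF summ, of "{..<n}"] nn by (simp add: sum.nat_diff_reindex)
  moreover have "expectation (\<lambda>\<omega>. Y n \<omega> * Y n \<omega>) \<le> 1"
  proof -
    have "expectation (\<lambda>\<omega>. Y n \<omega> * Y n \<omega>) \<le> expectation (\<lambda>\<omega>. 1)"
      by (intro integral_mono int2) (auto intro: abs_le_square_iff[THEN iffD1, of _ 1, simplified power2_eq_square, simplified] bd)
    then show ?thesis by (simp add: prob_space)
  qed
  ultimately show ?case using Suc.IH by (simp add: algebra_simps)
qed

text \<open>By the linear second moment bound, the squared average over the first
  \<open>n\<^sup>2\<close> terms has mean at most \<open>c / n\<^sup>2\<close>. The series of these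
  squares therefore has finite expectation, is almost surely finite, and its terms tend to
  0.\<close>

lemma (in prob_space) strong_law_summable_correlations:
  fixes Y :: "nat \<Rightarrow> 'a \<Rightarrow> real"
  assumes meas [measurable]: "\<And>k. Y k \<in> borel_measurable M"
    and bd: "\<And>k \<omega>. \<bar>Y k \<omega>\<bar> \<le> 1"
    and corr: "\<And>j l. \<bar>expectation (\<lambda>\<omega>. Y j \<omega> * Y (Suc (j + l)) \<omega>)\<bar> \<le> \<phi> l"
    and summ: "summable \<phi>"
  shows "AE \<omega> in M. (\<lambda>n. (\<Sum>k<n. Y k \<omega>) / real n) \<longlonglongrightarrow> 0"
proof -
  define c where "c = 1 + 2 * suminf \<phi>"
  have nn: "\<phi> l \<ge> 0" for l
    using corr[of 0 l] by linarith
  have c: "c \<ge> 0" unfolding c_def using suminf_nonneg[OF summ nn] by simp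
  define A where "A n \<omega> = ((\<Sum>k<n\<^sup>2. Y k \<omega>) / real (n\<^sup>2))\<^sup>2" for n \<omega>
  have [measurable]: "A n \<in> borel_measurable M" for n
    unfolding A_def by measurable
  have bA: "\<bar>A n \<omega>\<bar> \<le> 1" for n \<omega>
  proof -
    have "\<bar>\<Sum>k<n\<^sup>2. Y k \<omega>\<bar> \<le> real (n\<^sup>2)"
      using sum_norm_bound[of "{..<n\<^sup>2}" "\<lambda>k. Y k \<omega>" 1] bd by simp
    then have "\<bar>(\<Sum>k<n\<^sup>2. Y k \<omega>) / real (n\<^sup>2)\<bar> \<le> 1"
      by (cases "n = 0") (auto simp: field_simps)
    then show ?thesis unfolding A_def by (simp only: abs_power2 abs_square_le_1)
  qed
  have intA: "integrable M (A n)" for n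
    by (rule integrable_const_bound[where B = 1]) (use bA in auto)
  have EA: "expectation (A n) \<le> c * inverse (real n ^ 2)" for n
  \<comment> \<open>For \<open>n = 0\<close> both sides vanish, as division by zero yields
    0.\<close>
  proof (cases "n = 0")
    case True then show ?thesis by (simp add: A_def[abs_def])
  next
    case False
    have "expectation (A n) = expectation (\<lambda>\<omega>. (\<Sum>k<n\<^sup>2. Y k \<omega>)\<^sup>2) / (real (n\<^sup>2))\<^sup>2"
      unfolding A_def power_divide by simp
    also have "\<dots> \<le> (real (n\<^sup>2) * c) / (real (n\<^sup>2))\<^sup>2"
      unfolding c_def by (intro divide_right_mono second_moment_sum_le assms) auto
    also have "\<dots> = c * inverse (real n ^ 2)"
      using False by (simp add: field_simps power2_eq_square)
    finally show ?thesis .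
  qed
  have sumA: "summable (\<lambda>n. expectation (A n))"
  proof (rule summable_comparison_test'[where N = 0])
    show "summable (\<lambda>n. c * inverse (real n ^ 2))"
      by (intro summable_mult inverse_power_summable) auto
    show "norm (expectation (A n)) \<le> c * inverse (real n ^ 2)" for n
      using EA[of n] Bochner_Integration.integral_nonneg[of M "A n"] by (simp add: A_def[abs_def])
  qed
  have "(\<integral>\<^sup>+ \<omega>. (\<Sum>n. ennreal (A n \<omega>)) \<partial>M) = (\<Sum>n. \<integral>\<^sup>+ \<omega>. ennreal (A n \<omega>) \<partial>M)"
    by (rule nn_integral_suminf) measurable
  also have "\<dots> = (\<Sum>n. ennreal (expectation (A n)))"
    by (intro suminf_cong nn_integral_eq_integral intA) (simp add: A_def)
  also have "\<dots> = ennreal (\<Sum>n. expectation (A n))"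
    by (intro suminf_ennreal2 sumA Bochner_Integration.integral_nonneg) (simp add: A_def)
  finally have "(\<integral>\<^sup>+ \<omega>. (\<Sum>n. ennreal (A n \<omega>)) \<partial>M) \<noteq> \<infinity>" by simp
  then have "AE \<omega> in M. (\<Sum>n. ennreal (A n \<omega>)) \<noteq> \<infinity>"
    by (intro nn_integral_noteq_infinite) auto
  then show ?thesis
  proof eventually_elim
    case (elim \<omega>)
    have "summable (\<lambda>n. A n \<omega>)"
      by (rule summable_suminf_not_top) (use elim in \<open>auto simp: A_def\<close>)
    then have "(\<lambda>n. A n \<omega>) \<longlonglongrightarrow> 0" by (rule summable_LIMSEQ_zero)
    from tendsto_real_sqrt[OF this]
    have "(\<lambda>n. (\<Sum>k<n\<^sup>2. Y k \<omega>) / real (n\<^sup>2)) \<longlonglongrightarrow> 0"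
      by (simp only: A_def real_sqrt_abs real_sqrt_zero tendsto_rabs_zero_iff)
    then show ?case by (rule averages_tendsto_0_from_squares[OF bd])
  qed
qed

text \<open>An empirical mean is the empirical objective of a loss that ignores its parameter, here
  of unit type. Means and objectives thus unfold to the same expression and can be compared
  termwise.\<close>

abbreviation empirical_mean :: "('b \<Rightarrow> real) \<Rightarrow> (nat \<Rightarrow> 'w \<Rightarrow> 'b) \<Rightarrow> nat \<Rightarrow> 'w \<Rightarrow> real" where
  "empirical_mean g \<xi> K \<omega> \<equiv> emp_objective (\<lambda>_. g) \<xi> K \<omega> ()"

lemma empirical_mean_altdef:
  "empirical_mean g \<xi> K \<omega> = (\<Sum>k<K. g (\<xi> (Suc k) \<omega>)) / real K"
  by (simp add: emp_objective_def sum.atLeast1_atMost_eq)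

lemma empirical_mean_abs_diff_le:
  assumes "\<And>k. k \<ge> 1 \<Longrightarrow> \<bar>g (\<xi> k \<omega>) - h (\<xi> k \<omega>)\<bar> \<le> e" "e \<ge> 0"
  shows "\<bar>empirical_mean g \<xi> K \<omega> - empirical_mean h \<xi> K \<omega>\<bar> \<le> e"
proof (cases "K = 0")
  case True
  then show ?thesis using assms by (simp add: emp_objective_def)
next
  case False
  have "\<bar>\<Sum>k<K. g (\<xi> (Suc k) \<omega>) - h (\<xi> (Suc k) \<omega>)\<bar> \<le> real K * e"
    using sum_norm_bound[of "{..<K}" "\<lambda>k. g (\<xi> (Suc k) \<omega>) - h (\<xi> (Suc k) \<omega>)" e] assms by simp
  then show ?thesis
    using False by (simp add: empirical_mean_altdef sum_subtractf field_simps
        flip: diff_divide_distrib)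
qed

section \<open>Total variation, conditional laws and mixing coefficients\<close>

lemma tv_dist_upper:
  assumes "prob_space P" "prob_space Q" "A \<in> sets P"
  shows "\<bar>measure P A - measure Q A\<bar> \<le> tv_dist P Q"
  unfolding tv_dist_def
proof (rule cSUP_upper[OF assms(3)])
  \<comment> \<open>The supremum is taken in the reals, so it dominates its members only once
    boundedness is known.\<close>
  show "bdd_above ((\<lambda>A. \<bar>measure P A - measure Q A\<bar>) ` sets P)"
    using prob_space.prob_le_1[OF assms(1)] prob_space.prob_le_1[OF assms(2)]
    by (intro bdd_aboveI2[where M = 1])
       (smt (verit) measure_nonneg)
qed

lemma tv_dist_le_1:
  assumes "prob_space P" "prob_space Q"
  shows "tv_dist P Q \<le> 1"
  unfolding tv_dist_def
  using prob_space.prob_le_1[OF assms(1)] prob_space.prob_le_1[OF assms(2)]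
  by (intro cSUP_least) (auto, smt (verit) measure_nonneg)

text \<open>The \<open>Suc\<close> starts the series of mixing coefficients at lag 1.\<close>

locale mixing_samples = prob_space M + P: prob_space P
  for M :: "'w measure" and P :: "'b measure" +
  fixes \<xi> :: "nat \<Rightarrow> 'w \<Rightarrow> 'b"
  assumes sample_measurable: "\<And>k. k \<ge> 1 \<Longrightarrow> \<xi> k \<in> measurable M P"
    and summable_phi: "summable (\<lambda>k. phi_mixing M P \<xi> (Suc k))"
begin

lemma past_events_subset_sets: "past_events M P \<xi> k \<subseteq> sets M"
  unfolding past_events_def
  by (intro sets.sigma_sets_subset) (auto intro!: measurable_sets[OF sample_measurable])

lemma prob_space_cond_law:
  assumes "prob B > 0" "n \<ge> 1"
  shows "prob_space (cond_law M P \<xi> n B)"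
proof -
  interpret U: prob_space "uniform_measure M B"
    using assms by (intro prob_space_uniform_measure) (auto simp: emeasure_eq_measure)
  show ?thesis unfolding cond_law_def
    using sample_measurable[OF assms(2)] by (intro U.prob_space_distr) simp
qed

text \<open>Conditional laws are probability measures, so the family under the supremum is bounded
  by 2 and the supremum dominates each member.\<close>

lemma phi_mixing_upper:
  assumes "k \<ge> 1" "B \<in> past_events M P \<xi> k" "prob B > 0"
  shows "2 * tv_dist (cond_law M P \<xi> (k + l) B) P \<le> phi_mixing M P \<xi> l"
proof -
  have "bdd_above ((\<lambda>(k, B). 2 * tv_dist (cond_law M P \<xi> (k + l) B) P) `
      {(k, B). 1 \<le> k \<and> B \<in> past_events M P \<xi> k \<and> prob B > 0})"
    using tv_dist_le_1[OF prob_space_cond_law P.prob_space_axioms]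
    by (intro bdd_aboveI2[where M = 2]) fastforce
  from cSUP_upper[OF _ this, of "(k, B)"] assms show ?thesis
    unfolding phi_mixing_def by simp
qed

text \<open>This is the total variation bound for the conditional law, multiplied by
  \<open>prob B\<close>. In this form it also covers null events \<open>B\<close>, for which both
  sides are 0.\<close>

lemma cond_law_deviation:
  assumes "k \<ge> 1" "B \<in> past_events M P \<xi> k" "A \<in> sets P"
  shows "\<bar>prob (B \<inter> (\<xi> (k + l) -` A \<inter> space M)) - prob B * measure P A\<bar>
    \<le> prob B * (phi_mixing M P \<xi> l / 2)"
proof (cases "prob B = 0")
  case True
  have "B \<in> events" using assms past_events_subset_sets by blast
  then have "prob (B \<inter> (\<xi> (k + l) -` A \<inter> space M)) \<le> prob B"
    by (intro finite_measure_mono) auto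
  then show ?thesis using True by (simp add: antisym)
next
  case False
  then have pos: "prob B > 0" by (simp add: zero_less_measure_iff)
  have xi: "\<xi> (k + l) \<in> measurable M P" using assms by (intro sample_measurable) simp
  have U: "measure (cond_law M P \<xi> (k + l) B) A
      = prob (B \<inter> (\<xi> (k + l) -` A \<inter> space M)) / prob B"
    unfolding cond_law_def using assms xi pos
    by (subst measure_distr)
       (auto simp: measure_uniform_measure emeasure_eq_measure intro!: measurable_sets[OF xi])
  have "\<bar>measure (cond_law M P \<xi> (k + l) B) A - measure P A\<bar>
      \<le> tv_dist (cond_law M P \<xi> (k + l) B) P"
    using assms pos
    by (intro tv_dist_upper prob_space_cond_law P.prob_space_axioms) (auto simp: cond_law_def)
  also have "\<dots> \<le> phi_mixing M P \<xi> l / 2"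
    using phi_mixing_upper[OF assms(1,2) pos, of l] by simp
  finally have "prob B * \<bar>measure (cond_law M P \<xi> (k + l) B) A - measure P A\<bar>
      \<le> prob B * (phi_mixing M P \<xi> l / 2)"
    by (intro mult_left_mono) auto
  also have "prob B * \<bar>measure (cond_law M P \<xi> (k + l) B) A - measure P A\<bar>
      = \<bar>prob B * (measure (cond_law M P \<xi> (k + l) B) A - measure P A)\<bar>"
    by (simp add: abs_mult)
  finally show ?thesis using pos by (simp add: U algebra_simps)
qed

section \<open>Strong law for indicators and for bounded functions\<close>

lemma strong_law_indicator:
  assumes A: "A \<in> sets P"
  shows "AE \<omega> in M. (\<lambda>K. empirical_mean (indicator A) \<xi> K \<omega>) \<longlonglongrightarrow> measure P A"
proof -
  define p where "p = measure P A"
  have p: "0 \<le> p" "p \<le> 1" by (auto simp: p_def)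
  define E where "E k = \<xi> k -` A \<inter> space M" for k
  have E: "E k \<in> events" if "k \<ge> 1" for k
    unfolding E_def using that A by (intro measurable_sets[OF sample_measurable])
  \<comment> \<open>The samples need not have law \<open>P\<close>, so centring at \<open>p\<close>
    instead of the mean leaves a bias, which the correlation bound has to absorb.\<close>
  define Y where "Y k \<omega> = indicator (E (Suc k)) \<omega> - p" for k \<omega>
  have meas [measurable]: "Y k \<in> borel_measurable M" for k
    unfolding Y_def using E by (intro borel_measurable_diff borel_measurable_indicator) auto
  have corr: "\<bar>expectation (\<lambda>\<omega>. Y j \<omega> * Y (Suc (j + l)) \<omega>)\<bar> \<le> phi_mixing M P \<xi> (Suc l)" for j l
  proof -
    \<comment> \<open>\<open>Y k\<close> belongs to sample \<open>Suc k\<close>, so the two events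
      are those of samples \<open>Suc j\<close> and \<open>Suc j + Suc l\<close>, at lag
      \<open>Suc l\<close>.\<close>
    define B D where "B = E (Suc j)" and "D = E (Suc j + Suc l)"
    have BD: "B \<in> events" "D \<in> events" by (auto simp: B_def D_def E)
    have pe: "B \<in> past_events M P \<xi> (Suc j)" "space M \<in> past_events M P \<xi> (Suc j)"
      unfolding past_events_def B_def E_def using A by (auto intro!: sigma_sets.Basic sigma_sets_top)
    have "(\<lambda>\<omega>. Y j \<omega> * Y (Suc (j + l)) \<omega>) =
        (\<lambda>\<omega>. indicator (B \<inter> D) \<omega> - p * indicator B \<omega> - p * indicator D \<omega> + p * p)"
      by (auto simp: Y_def B_def D_def algebra_simps indicator_inter_arith)
    then have "expectation (\<lambda>\<omega>. Y j \<omega> * Y (Suc (j + l)) \<omega>)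
        = prob (B \<inter> D) - p * prob B - p * prob D + p * p"
      using BD by (simp add: prob_space emeasure_eq_measure)
    \<comment> \<open>The first bracket measures the dependence of \<open>D\<close> on the past
      event \<open>B\<close>, the second the bias of \<open>D\<close>. Each costs half a mixing
      coefficient.\<close>
    also have "\<dots> = (prob (B \<inter> D) - prob B * p) - p * (prob D - p)"
      by (simp add: algebra_simps)
    also have "\<bar>\<dots>\<bar> \<le> \<bar>prob (B \<inter> D) - prob B * p\<bar> + p * \<bar>prob D - p\<bar>"
      using p abs_triangle_ineq4[of "prob (B \<inter> D) - prob B * p" "p * (prob D - p)"]
      by (simp add: abs_mult)
    also have "\<dots> \<le> phi_mixing M P \<xi> (Suc l) / 2 + phi_mixing M P \<xi> (Suc l) / 2"
    proof (rule add_mono)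
      \<comment> \<open>Conditioning on the sure event \<open>space M\<close>, which belongs to
        every past, bounds the bias by the same coefficient.\<close>
      have d: "\<bar>prob D - p\<bar> \<le> phi_mixing M P \<xi> (Suc l) / 2"
        using cond_law_deviation[OF _ pe(2) A, of "Suc l", folded E_def, folded D_def] sets.sets_into_space[OF BD(2)]
        by (simp add: p_def prob_space Int_absorb1)
      have "p * \<bar>prob D - p\<bar> \<le> 1 * \<bar>prob D - p\<bar>" using p by (intro mult_right_mono) auto
      with d show "p * \<bar>prob D - p\<bar> \<le> phi_mixing M P \<xi> (Suc l) / 2" by simp
      have "prob B * (phi_mixing M P \<xi> (Suc l) / 2) \<le> 1 * (phi_mixing M P \<xi> (Suc l) / 2)"
        using order_trans[OF abs_ge_zero d] by (intro mult_right_mono) auto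
      with cond_law_deviation[OF _ pe(1) A, of "Suc l"]
      show "\<bar>prob (B \<inter> D) - prob B * p\<bar> \<le> phi_mixing M P \<xi> (Suc l) / 2"
        by (simp add: D_def p_def E_def)
    qed
    finally show ?thesis by simp
  qed
  have "\<bar>Y k \<omega>\<bar> \<le> 1" for k \<omega>
    using p by (auto simp: Y_def indicator_def)
  from strong_law_summable_correlations[OF meas this corr summable_phi] AE_space
  show ?thesis
  proof eventually_elim
    case (elim \<omega>)
    \<comment> \<open>At \<open>K = 0\<close> the left side is \<open>p\<close> while the empirical
      mean is 0, so the identity is claimed only eventually.\<close>
    have ev: "\<forall>\<^sub>F K in sequentially. (\<Sum>k<K. Y k \<omega>) / real K + p = empirical_mean (indicator A) \<xi> K \<omega>"
      using eventually_gt_at_top[of 0]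
    proof eventually_elim
      case (elim K)
      have "(indicator (E k) \<omega> :: real) = indicator A (\<xi> k \<omega>)" for k
        using \<open>\<omega> \<in> space M\<close> by (simp add: E_def indicator_def)
      then show ?case using elim
        by (simp add: empirical_mean_altdef Y_def sum_subtractf field_simps)
    qed
    have "(\<lambda>K. (\<Sum>k<K. Y k \<omega>) / real K + p) \<longlonglongrightarrow> 0 + p"
      by (intro tendsto_add elim tendsto_const)
    then show ?case using ev unfolding p_def by (simp add: tendsto_cong)
  qed
qed

theorem strong_law_bounded:
  assumes f [measurable]: "f \<in> borel_measurable P"
    and bd: "\<And>s. s \<in> space P \<Longrightarrow> \<bar>f s\<bar> \<le> L"
  shows "AE \<omega> in M. (\<lambda>K. empirical_mean f \<xi> K \<omega>) \<longlonglongrightarrow> (\<integral>s. f s \<partial>P)"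
proof -
  \<comment> \<open>\<open>h n\<close> rounds \<open>f\<close> down to the grid of mesh
    \<open>1 / Suc n\<close>. Boundedness of \<open>f\<close> makes it a finite combination of
    indicators on \<open>space P\<close>.\<close>
  define h where "h n s = real_of_int \<lfloor>f s * real (Suc n)\<rfloor> / real (Suc n)" for n s
  have h1: "\<bar>f s - h n s\<bar> \<le> 1 / real (Suc n)" for n s
  proof -
    have "\<bar>f s * real (Suc n) - real_of_int \<lfloor>f s * real (Suc n)\<rfloor>\<bar> \<le> 1" by linarith
    moreover have "f s - h n s = (f s * real (Suc n) - real_of_int \<lfloor>f s * real (Suc n)\<rfloor>) / real (Suc n)"
      unfolding h_def by (simp add: field_simps del: of_nat_Suc)
    ultimately show ?thesis by (simp add: divide_right_mono abs_divide del: of_nat_Suc)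
  qed
  have [measurable]: "h n \<in> borel_measurable P" for n unfolding h_def by measurable
  have intf: "integrable P f" by (rule P.integrable_const_bound[where B = L]) (use bd in auto)
  have "AE \<omega> in M. (\<lambda>K. empirical_mean (h n) \<xi> K \<omega>) \<longlonglongrightarrow> (\<integral>s. h n s \<partial>P)" for n
  proof -
    \<comment> \<open>The range \<open>J\<close> is finite and contains every value of the floor,
      since \<open>\<bar>f s * Suc n\<bar>\<close> is at most \<open>L * Suc n\<close>.\<close>
    define N where "N = \<lceil>L * real (Suc n)\<rceil> + 1"
    define J where "J = {- N..N}"
    define A where "A j = {s \<in> space P. \<lfloor>f s * real (Suc n)\<rfloor> = j}" for j
    have A [measurable]: "A j \<in> sets P" for j unfolding A_def by measurable
    have hs: "h n s = (\<Sum>j\<in>J. real_of_int j / real (Suc n) * indicator (A j) s)"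
      if s: "s \<in> space P" for s
    proof -
      have "\<bar>f s * real (Suc n)\<bar> \<le> L * real (Suc n)"
        using bd[OF s] by (simp add: abs_mult mult_right_mono del: of_nat_Suc)
      then have "\<lfloor>f s * real (Suc n)\<rfloor> \<in> J" unfolding J_def N_def
        by (auto simp del: of_nat_Suc) linarith+
      moreover have "real_of_int j / real (Suc n) * indicator (A j) s
          = (if j = \<lfloor>f s * real (Suc n)\<rfloor> then h n s else 0)" for j
        using s by (auto simp: A_def h_def)
      ultimately show ?thesis by (simp add: J_def)
    qed
    have "AE \<omega> in M. \<forall>j\<in>J. (\<lambda>K. empirical_mean (indicator (A j)) \<xi> K \<omega>) \<longlonglongrightarrow> measure P (A j)"
      using strong_law_indicator[OF A] by (intro AE_ball_countable[THEN iffD2]) (auto simp: J_def)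
    with AE_space show ?thesis
    proof eventually_elim
      case (elim \<omega>)
      have "\<xi> (Suc k) \<omega> \<in> space P" for k
        using elim(1) by (intro measurable_space[OF sample_measurable]) auto
      then have "empirical_mean (h n) \<xi> K \<omega>
          = (\<Sum>j\<in>J. real_of_int j / real (Suc n) * empirical_mean (indicator (A j)) \<xi> K \<omega>)" for K
        unfolding empirical_mean_altdef
        by (simp add: hs sum_divide_distrib sum_distrib_left sum.swap[of _ J] mult_ac del: of_nat_Suc)
      moreover have "(\<integral>s. h n s \<partial>P) = (\<Sum>j\<in>J. real_of_int j / real (Suc n) * measure P (A j))"
        using A by (simp add: hs P.emeasure_eq_measure cong: Bochner_Integration.integral_cong del: of_nat_Suc)
      moreover have "(\<lambda>K. \<Sum>j\<in>J. real_of_int j / real (Suc n) * empirical_mean (indicator (A j)) \<xi> K \<omega>)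
          \<longlonglongrightarrow> (\<Sum>j\<in>J. real_of_int j / real (Suc n) * measure P (A j))"
        using elim(2) by (intro tendsto_sum tendsto_mult tendsto_const) blast
      ultimately show ?case by (simp only:)
    qed
  qed
  \<comment> \<open>A single null set serves all \<open>n\<close>, so that \<open>n\<close> may be
    chosen afterwards in terms of \<open>e\<close>.\<close>
  then have "AE \<omega> in M. \<forall>n. (\<lambda>K. empirical_mean (h n) \<xi> K \<omega>) \<longlonglongrightarrow> (\<integral>s. h n s \<partial>P)"
    by (simp add: AE_all_countable)
  then show ?thesis
  proof eventually_elim
    case (elim \<omega>)
    show ?case
    proof (rule metric_LIMSEQ_I)
      fix e :: real assume "e > 0"
      obtain n where n: "1 / real (Suc n) < e / 3"
        using nat_approx_posE[of "e / 3"] \<open>e > 0\<close> by auto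
      have inth: "integrable P (h n)"
      proof (rule P.integrable_const_bound[where B = "L + 1"])
        have "\<bar>h n s\<bar> \<le> L + 1" if "s \<in> space P" for s
        proof -
          have "1 / real (Suc n) \<le> 1" by simp
          with h1[of s n] bd[OF that] show ?thesis by linarith
        qed
        then show "AE s in P. norm (h n s) \<le> L + 1" by simp
      qed simp
      have "\<bar>(\<integral>s. f s \<partial>P) - (\<integral>s. h n s \<partial>P)\<bar> = \<bar>\<integral>s. f s - h n s \<partial>P\<bar>"
        using intf inth by simp
      also have "\<dots> \<le> (\<integral>s. \<bar>f s - h n s\<bar> \<partial>P)" by (rule integral_abs_bound)
      also have "\<dots> \<le> (\<integral>s. 1 / real (Suc n) \<partial>P)"
        using intf inth h1 by (intro integral_mono) auto
      finally have E1: "\<bar>(\<integral>s. f s \<partial>P) - (\<integral>s. h n s \<partial>P)\<bar> \<le> 1 / real (Suc n)"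
        by (simp add: P.prob_space)
      have E2: "\<bar>empirical_mean f \<xi> K \<omega> - empirical_mean (h n) \<xi> K \<omega>\<bar> \<le> 1 / real (Suc n)" for K
        by (rule empirical_mean_abs_diff_le) (use h1 in auto)
      obtain K0 where "\<And>K. K \<ge> K0 \<Longrightarrow>
          dist (empirical_mean (h n) \<xi> K \<omega>) (\<integral>s. h n s \<partial>P) < e / 3"
        using metric_LIMSEQ_D[of _ _ "e/3"] elim \<open>e > 0\<close> by (meson divide_pos_pos zero_less_numeral)
      note K0 = this
      have "dist (empirical_mean f \<xi> K \<omega>) (\<integral>s. f s \<partial>P) < e" if "K \<ge> K0" for K
      proof -
        have "dist (empirical_mean f \<xi> K \<omega>) (\<integral>s. f s \<partial>P)
            \<le> dist (empirical_mean f \<xi> K \<omega>) (empirical_mean (h n) \<xi> K \<omega>)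
              + (dist (empirical_mean (h n) \<xi> K \<omega>) (\<integral>s. h n s \<partial>P)
                 + dist (\<integral>s. h n s \<partial>P) (\<integral>s. f s \<partial>P))"
          by (meson add_left_mono dist_triangle order_trans)
        also have "\<dots> < e / 3 + (e / 3 + e / 3)"
          using order.strict_trans1[OF E1 n] order.strict_trans1[OF E2 n] K0[OF that]
          by (intro add_strict_mono) (simp_all only: dist_real_def abs_minus_commute)
        finally show ?thesis by simp
      qed
      then show "\<exists>K0. \<forall>K\<ge>K0. dist (empirical_mean f \<xi> K \<omega>) (\<integral>s. f s \<partial>P) < e" by blast
    qed
  qed
qed

end

section \<open>Infima of bounded convex functions over open sets\<close>

text \<open>If \<open>w0\<close> is a relative interior point of \<open>X\<close>, the dilates \<open>(1 - t) *\<^sub>R x + t *\<^sub>R X\<close> contain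
  a relative neighbourhood of \<open>(1 - t) *\<^sub>R x + t *\<^sub>R w0\<close>, which meets every dense subset of \<open>X\<close>.\<close>

lemma convex_dense_approx:
  fixes X :: "'a::euclidean_space set"
  assumes X: "convex X" and D: "D \<subseteq> X" "X \<subseteq> closure D" and x: "x \<in> X" and e: "e > 0"
  obtains d w t where "d \<in> D" "w \<in> X" "0 < t" "t < e" "t \<le> 1"
    "d = (1 - t) *\<^sub>R x + t *\<^sub>R w" "dist d x < e"
proof -
  obtain w0 r where w0: "w0 \<in> X" and r: "r > 0" "ball w0 r \<inter> affine hull X \<subseteq> X"
    using x rel_interior_eq_empty[OF X] mem_rel_interior_ball[of _ X] by blast
  \<comment> \<open>This choice gives both \<open>t < e\<close> and
    \<open>dist p x \<le> e / 2\<close>; the 1 in the denominator covers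
    \<open>w0 = x\<close>.\<close>
  define t where "t = min 1 (e / (2 * (1 + norm (w0 - x))))"
  define p where "p = (1 - t) *\<^sub>R x + t *\<^sub>R w0"
  have n: "1 + norm (w0 - x) > 0" by (simp add: add_pos_nonneg)
  have t: "0 < t" "t \<le> 1" using e n by (auto simp: t_def)
  have tn: "t * (1 + norm (w0 - x)) \<le> e / 2"
  proof -
    have "t \<le> (e / 2) / (1 + norm (w0 - x))" by (simp add: t_def)
    then show ?thesis using pos_le_divide_eq[OF n] by blast
  qed
  moreover have "t * 1 \<le> t * (1 + norm (w0 - x))" using t by (intro mult_left_mono) auto
  ultimately have te: "t < e" using e by linarith
  have "p - x = t *\<^sub>R (w0 - x)" by (simp add: p_def algebra_simps)
  then have "dist p x = t * norm (w0 - x)" using t by (simp add: dist_norm)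
  then have px: "dist p x \<le> e / 2" using tn t by (simp add: algebra_simps)
  have "p \<in> X" unfolding p_def using X x w0 t by (simp add: convex_alt)
  then have "p \<in> closure D" using D by blast
  moreover have "min (e / 2) (t * r) > 0" using e t r by simp
  ultimately obtain d where d: "d \<in> D" "dist d p < min (e / 2) (t * r)"
    unfolding closure_approachable by blast
  \<comment> \<open>\<open>w\<close> is the preimage of \<open>d\<close> under the dilation with
    centre \<open>x\<close> and ratio \<open>t\<close>. It lies within \<open>r\<close> of
    \<open>w0\<close> because \<open>d\<close> lies within \<open>t * r\<close> of
    \<open>p\<close>.\<close>
  define w where "w = (1 / t) *\<^sub>R d + (1 - 1 / t) *\<^sub>R x"
  have dw: "d = (1 - t) *\<^sub>R x + t *\<^sub>R w"
    using t by (simp add: w_def algebra_simps)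
  have "d - p = t *\<^sub>R (w - w0)" unfolding dw p_def by (simp add: algebra_simps)
  then have "t * dist w w0 < t * r" using d t by (simp add: dist_norm)
  then have "w \<in> ball w0 r" using t by (simp add: dist_commute)
  moreover have "w \<in> affine hull X"
    unfolding w_def using d(1) D(1) x hull_subset[of X affine]
    by (intro mem_affine affine_affine_hull) auto
  ultimately have "w \<in> X" using r by blast
  moreover have "dist d x < e" using dist_triangle[of d x p] d(2) px by simp
  ultimately show ?thesis using that d(1) t te dw by blast
qed

text \<open>A convex function may jump up at the relative boundary, so density and continuity do not
  suffice. Instead, points \<open>d\<close> of \<open>D\<close> near \<open>x\<close> lie on
  segments from \<open>x\<close> to some \<open>w\<close> in \<open>X\<close> at a small parameter
  \<open>t\<close>, and convexity gives \<open>f d \<le> f x + 2 * L * t\<close>. Infima over open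
  sets may thus be taken over a countable set.\<close>

lemma convex_ge_INF_dense:
  fixes f :: "'a::euclidean_space \<Rightarrow> real"
  assumes f: "convex_on X f" and bd: "\<And>y. y \<in> X \<Longrightarrow> \<bar>f y\<bar> \<le> L"
    and D: "D \<subseteq> X" "X \<subseteq> closure D" and U: "open U" and x: "x \<in> X" "x \<in> U"
  shows "(INF d\<in>D \<inter> U. f d) \<le> f x"
proof (rule field_le_epsilon)
  fix \<delta> :: real assume \<delta>: "\<delta> > 0"
  have L: "L \<ge> 0" using bd[OF x(1)] by linarith
  obtain e where e: "e > 0" "ball x e \<subseteq> U" using U x open_contains_ball by blast
  \<comment> \<open>The second bound makes \<open>2 * L * t \<le> \<delta>\<close>; the added 1
    keeps the denominator positive when \<open>L = 0\<close>.\<close>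
  define e' where "e' = min e (\<delta> / (2 * L + 1))"
  have e': "e' > 0" using e \<delta> L by (simp add: e'_def)
  obtain d w t where d: "d \<in> D" "w \<in> X" "0 < t" "t < e'" "t \<le> 1"
    "d = (1 - t) *\<^sub>R x + t *\<^sub>R w" "dist d x < e'"
    using convex_dense_approx[OF convex_on_imp_convex[OF f] D x(1) e'] by blast
  have "d \<in> U" using d(7) e by (auto simp: e'_def dist_commute subset_iff)
  have "f d \<le> (1 - t) * f x + t * f w"
    unfolding d(6) using d x by (intro convex_onD[OF f]) auto
  also have "\<dots> = f x + t * (f w - f x)" by (simp add: algebra_simps)
  also have "t * (f w - f x) \<le> t * (2 * L)"
    using bd[OF x(1)] bd[OF d(2)] d(3) by (intro mult_left_mono) auto
  also have "t * (2 * L) \<le> \<delta>"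
  proof -
    have "t \<le> \<delta> / (2 * L + 1)" using d(4) by (simp add: e'_def)
    then have "t * (2 * L + 1) \<le> \<delta>" using L by (simp add: pos_le_divide_eq)
    then show ?thesis using d(3) by (simp add: algebra_simps)
  qed
  finally have "f d \<le> f x + \<delta>" by simp
  moreover have "bdd_below (f ` (D \<inter> U))"
  proof (rule bdd_belowI2)
    show "- L \<le> f y" if "y \<in> D \<inter> U" for y using bd[of y] that D by fastforce
  qed
  ultimately show "(INF d\<in>D \<inter> U. f d) \<le> f x + \<delta>"
    using d(1) \<open>d \<in> U\<close> by (intro cINF_lower2) auto
qed

text \<open>The point \<open>(x, a)\<close> lies in the open complement of the epigraph, together
  with a ball; the slice of this ball at height \<open>a\<close> gives the neighbourhood.\<close>

lemma closed_epigraph_lsc: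
  fixes f :: "'a::euclidean_space \<Rightarrow> real"
  assumes f: "closed (epigraph X f)" and x: "x \<in> X" "a < f x"
  obtains e where "e > 0" "\<And>y. y \<in> X \<Longrightarrow> dist y x < e \<Longrightarrow> a < f y"
proof -
  have "(x, a) \<in> - epigraph X f" using x by (simp add: mem_epigraph)
  then obtain e where e: "e > 0" "ball (x, a) e \<subseteq> - epigraph X f"
    using f open_contains_ball[of "- epigraph X f"] by blast
  have "a < f y" if "y \<in> X" "dist y x < e" for y
  proof -
    have "(y, a) \<in> ball (x, a) e" using that by (simp add: dist_Pair_Pair dist_commute)
    then have "(y, a) \<notin> epigraph X f" using e by blast
    then show ?thesis using that by (simp add: mem_epigraph)
  qed
  then show ?thesis using that e by blast
qed

text \<open>At a height \<open>L\<close> above the whole graph, the slice of the epigraph is all of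
  \<open>X\<close>.\<close>

lemma closed_epigraph_bounded_imp_closed:
  fixes f :: "'a::euclidean_space \<Rightarrow> real"
  assumes f: "closed (epigraph X f)" and bd: "\<And>y. y \<in> X \<Longrightarrow> f y \<le> L"
  shows "closed X"
proof -
  have "X = (\<lambda>x. (x, L)) -` epigraph X f" using bd by (auto simp: mem_epigraph)
  moreover have "closed ((\<lambda>x. (x, L)) -` epigraph X f)"
    by (intro closed_vimage f continuous_intros)
  ultimately show ?thesis by simp
qed

text \<open>Each ball contains \<open>x\<close>, so by convexity no infimum exceeds
  \<open>f x\<close>. The balls shrink to \<open>x\<close>, so lower semicontinuity bounds the
  infima from below in the limit.\<close>

lemma INF_shrinking_balls_tendsto:
  fixes f :: "'a::euclidean_space \<Rightarrow> real"
  assumes f: "closed_convex_proper_on X f" and bd: "\<And>y. y \<in> X \<Longrightarrow> \<bar>f y\<bar> \<le> L"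
    and D: "D \<subseteq> X" "X \<subseteq> closure D" and x: "x \<in> X"
    and c: "\<And>n. c n \<in> D" "\<And>n. dist (c n) x < 1 / real (Suc n)"
  shows "(\<lambda>n. INF d\<in>D \<inter> ball (c n) (1 / real (Suc n)). f d) \<longlonglongrightarrow> f x"
proof (rule order_tendstoI)
  fix b assume b: "f x < b"
  have "(INF d\<in>D \<inter> ball (c n) (1 / real (Suc n)). f d) \<le> f x" for n
    using f bd D x c(2)[of n] unfolding closed_convex_proper_on_def
    by (intro convex_ge_INF_dense[where X = X and L = L]) (auto simp del: of_nat_Suc)
  then show "\<forall>\<^sub>F n in sequentially. (INF d\<in>D \<inter> ball (c n) (1 / real (Suc n)). f d) < b"
    using b by (intro always_eventually allI) (rule order.strict_trans1)
next
  fix a assume "a < f x"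
  \<comment> \<open>Passing to the infimum keeps only a weak inequality, hence the intermediate
    \<open>a'\<close>.\<close>
  then obtain a' where a': "a < a'" "a' < f x" using dense by blast
  obtain e where e: "e > 0" "\<And>y. y \<in> X \<Longrightarrow> dist y x < e \<Longrightarrow> a' < f y"
    using closed_epigraph_lsc[of X f x a'] f x a' unfolding closed_convex_proper_on_def by blast
  have "(\<lambda>n. 1 / real (Suc n)) \<longlonglongrightarrow> 0"
    using lim_inverse_n' LIMSEQ_Suc by blast
  then have "\<forall>\<^sub>F n in sequentially. 1 / real (Suc n) < e / 2"
    using e by (intro order_tendstoD) auto
  then show "\<forall>\<^sub>F n in sequentially. a < (INF d\<in>D \<inter> ball (c n) (1 / real (Suc n)). f d)"
  proof eventually_elim
    case (elim n)
    have "a' \<le> (INF d\<in>D \<inter> ball (c n) (1 / real (Suc n)). f d)"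
    proof (rule cINF_greatest)
      show "D \<inter> ball (c n) (1 / real (Suc n)) \<noteq> {}"
        using c(1)[of n] by (metis IntI centre_in_ball empty_iff of_nat_0_less_iff zero_less_Suc zero_less_divide_1_iff)
      fix d assume d: "d \<in> D \<inter> ball (c n) (1 / real (Suc n))"
      \<comment> \<open>The balls are centred at \<open>c n\<close>, not at \<open>x\<close>; two
        distances below \<open>e / 2\<close> add up.\<close>
      have "dist d x < e"
        using dist_triangle[of d x "c n"] c(2)[of n] d elim
        by (simp add: dist_commute del: of_nat_Suc)
      then show "a' \<le> f d" using e d D by (intro less_imp_le e) auto
    qed
    then show ?case using a' by simp
  qed
qed

section \<open>Consistency of optimal values and solutions\<close>

lemma optimal_solution_iff:
  "optimal_solution f X x \<longleftrightarrow> x \<in> X \<and> (\<forall>y\<in>X. f x \<le> f y)"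
  unfolding optimal_solution_def is_arg_min_linorder by auto

lemma optimal_value_eq:
  assumes "optimal_solution f X x"
  shows "optimal_value f X = f x"
  unfolding optimal_value_def using assms unfolding optimal_solution_iff
  by (intro cInf_eq_minimum) auto

lemma convex_on_emp_objective:
  assumes "convex X" "\<And>k. k \<ge> 1 \<Longrightarrow> convex_on X (\<lambda>x. loss x (\<xi> k \<omega>))"
  shows "convex_on X (emp_objective loss \<xi> K \<omega>)"
proof -
  have "convex_on X (\<lambda>x. \<Sum>k\<in>I. loss x (\<xi> k \<omega>))" if "finite I" "I \<subseteq> {1..}" for I
    using that
  proof (induction I rule: finite_induct)
    case empty
    then show ?case using assms(1) by (simp add: convex_on_const)
  next
    case (insert i I)
    then show ?case using assms(2) by (auto intro!: convex_on_add)
  qed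
  from this[of "{1..K}"] show ?thesis
    unfolding emp_objective_def by (intro convex_on_cmul) auto
qed

text \<open>The exceptional null set does not depend on \<open>S\<close> or \<open>a\<close>,
  because the strong law is applied only to countably many ball infima. The margin
  \<open>b > a\<close> allows comparison with quantities that merely converge to
  \<open>a\<close>.\<close>

lemma (in mixing_samples) emp_objective_eventually_greater_on_compact:
  fixes loss :: "'a::euclidean_space \<Rightarrow> 'b \<Rightarrow> real"
  assumes ccp: "\<And>s. s \<in> space P \<Longrightarrow> closed_convex_proper_on X (\<lambda>x. loss x s)"
    and meas: "\<And>x. x \<in> X \<Longrightarrow> loss x \<in> borel_measurable P"
    and bd: "\<And>x s. x \<in> X \<Longrightarrow> s \<in> space P \<Longrightarrow> \<bar>loss x s\<bar> \<le> L"
  shows "AE \<omega> in M. \<forall>S a. compact S \<longrightarrow> S \<subseteq> X \<longrightarrow> (\<forall>x\<in>S. a < true_objective loss P x) \<longrightarrow>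
      (\<exists>b>a. \<forall>\<^sub>F K in sequentially. \<forall>x\<in>S. b < emp_objective loss \<xi> K \<omega> x)"
proof -
  obtain D where D: "countable D" "D \<subseteq> X" "X \<subseteq> closure D"
    using separable[of X] by blast
  define U where "U = (\<lambda>(d, n). ball (d :: 'a) (1 / real (Suc n)))"
  \<comment> \<open>Taking the infimum over the countable set \<open>D \<inter> U i\<close> makes
    \<open>g i\<close> measurable; convexity still makes it a lower bound of the loss on all of
    \<open>X \<inter> U i\<close>.\<close>
  define g where "g i s = (INF c\<in>D \<inter> U i. loss c s)" for i s
  have g_meas: "g i \<in> borel_measurable P" for i
    unfolding g_def using D meas by (intro borel_measurable_cINF_real) auto
  have g_le: "g i s \<le> loss x s" if "s \<in> space P" "x \<in> X" "x \<in> U i" for i s x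
    unfolding g_def using ccp[OF that(1)] bd that D
    by (intro convex_ge_INF_dense[where X = X and L = L])
       (auto simp: closed_convex_proper_on_def U_def split: prod.splits)
  have g_bd: "\<bar>g i s\<bar> \<le> L" if i: "i \<in> D \<times> UNIV" and s: "s \<in> space P" for i s
  proof -
    obtain d n where dn: "i = (d, n)" "d \<in> D" using i by auto
    have dU: "d \<in> U i" by (simp add: dn U_def)
    have "g i s \<le> L" using g_le[OF s _ dU] bd[OF _ s, of d] dn D by fastforce
    moreover have "- L \<le> g i s" unfolding g_def
    proof (rule cINF_greatest)
      show "D \<inter> U i \<noteq> {}" using dU dn by auto
      show "- L \<le> loss c s" if "c \<in> D \<inter> U i" for c using bd[OF _ s, of c] that D by fastforce
    qed
    ultimately show ?thesis by linarith
  qed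
  \<comment> \<open>As the balls shrink to \<open>x\<close>, dominated convergence with the constant
    \<open>L\<close> carries the pointwise limit of the infima over to their means.\<close>
  have g_lim: "\<exists>i\<in>D \<times> UNIV. x \<in> U i \<and> a < (\<integral>s. g i s \<partial>P)"
    if x: "x \<in> X" and a: "a < true_objective loss P x" for x a
  proof -
    have "\<exists>d\<in>D. dist d x < 1 / real (Suc n)" for n
      using x D(3) closure_approachable[of x D] by (auto simp del: of_nat_Suc)
    then obtain c where c: "\<And>n. c n \<in> D" "\<And>n. dist (c n) x < 1 / real (Suc n)" by metis
    have "(\<lambda>n. \<integral>s. g (c n, n) s \<partial>P) \<longlonglongrightarrow> (\<integral>s. loss x s \<partial>P)"
    proof (rule integral_dominated_convergence[where w = "\<lambda>_. L"])
      show "AE s in P. (\<lambda>n. g (c n, n) s) \<longlonglongrightarrow> loss x s"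
      proof (rule AE_I2)
        fix s assume s: "s \<in> space P"
        show "(\<lambda>n. g (c n, n) s) \<longlonglongrightarrow> loss x s"
          unfolding g_def U_def prod.case
          by (rule INF_shrinking_balls_tendsto[OF ccp[OF s] bd[OF _ s] D(2,3) x c])
      qed
      show "AE s in P. norm (g (c n, n) s) \<le> L" for n
        using g_bd[of "(c n, n)"] c by (intro AE_I2) auto
    qed (use g_meas meas x in auto)
    then have "\<forall>\<^sub>F n in sequentially. a < (\<integral>s. g (c n, n) s \<partial>P)"
      using a unfolding true_objective_def by (rule order_tendstoD)
    then obtain n where "a < (\<integral>s. g (c n, n) s \<partial>P)"
      using eventually_happens by force
    then show ?thesis using c[of n] by (intro bexI[of _ "(c n, n)"]) (auto simp: U_def simp del: of_nat_Suc)
  qed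
  have "AE \<omega> in M. \<forall>i\<in>D \<times> UNIV. (\<lambda>K. empirical_mean (g i) \<xi> K \<omega>) \<longlonglongrightarrow> (\<integral>s. g i s \<partial>P)"
    using strong_law_bounded[OF g_meas g_bd] D(1)
    by (subst AE_ball_countable) auto
  with AE_space show ?thesis
  proof eventually_elim
    case (elim \<omega>)
    have sp: "\<xi> k \<omega> \<in> space P" if "k \<ge> 1" for k
      using elim(1) that by (intro measurable_space[OF sample_measurable])
    show ?case
    proof (intro allI impI)
      fix S a assume S: "compact S" "S \<subseteq> X" and a: "\<forall>x\<in>S. a < true_objective loss P x"
      have "\<forall>x\<in>S. \<exists>i\<in>D \<times> UNIV. x \<in> U i \<and> a < (\<integral>s. g i s \<partial>P)"
        using g_lim S a by blast
      then obtain i where i: "\<And>x. x \<in> S \<Longrightarrow> i x \<in> D \<times> UNIV" "\<And>x. x \<in> S \<Longrightarrow> x \<in> U (i x)"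
        "\<And>x. x \<in> S \<Longrightarrow> a < (\<integral>s. g (i x) s \<partial>P)"
        by metis
      have opn: "open (U j)" for j by (auto simp: U_def split: prod.splits)
      obtain T where T: "T \<subseteq> S" "finite T" "S \<subseteq> (\<Union>x\<in>T. U (i x))"
        using compactE_image[OF S(1), of S "\<lambda>x. U (i x)"] opn i(2) by blast
      \<comment> \<open>The entry \<open>a + 1\<close> keeps the minimum defined when
        \<open>S\<close>, and with it \<open>T\<close>, is empty.\<close>
      define m where "m = Min (insert (a + 1) ((\<lambda>x. \<integral>s. g (i x) s \<partial>P) ` T))"
      have "a < m" unfolding m_def using T i(3) by auto
      then obtain b where b: "a < b" "b < m" using dense by blast
      have lt: "b < (\<integral>s. g (i x) s \<partial>P)" if "x \<in> T" for x
        using b(2) T(2) that unfolding m_def by auto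
      have "\<forall>\<^sub>F K in sequentially. \<forall>x\<in>T. b < empirical_mean (g (i x)) \<xi> K \<omega>"
      proof (intro eventually_ball_finite T(2) ballI)
        fix x assume x: "x \<in> T"
        then have "(\<lambda>K. empirical_mean (g (i x)) \<xi> K \<omega>) \<longlonglongrightarrow> (\<integral>s. g (i x) s \<partial>P)"
          using elim(2) i(1) T(1) by blast
        then show "\<forall>\<^sub>F K in sequentially. b < empirical_mean (g (i x)) \<xi> K \<omega>"
          using lt[OF x] by (rule order_tendstoD)
      qed
      then have "\<forall>\<^sub>F K in sequentially. \<forall>x\<in>S. b < emp_objective loss \<xi> K \<omega> x"
      proof eventually_elim
        case (elim K)
        show ?case
        proof
          fix y assume y: "y \<in> S"
          then obtain x where x: "x \<in> T" "y \<in> U (i x)" using T(3) by blast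
          have "b < empirical_mean (g (i x)) \<xi> K \<omega>" using elim x by blast
          also have "\<dots> \<le> emp_objective loss \<xi> K \<omega> y"
            unfolding emp_objective_def using y x S(2)
            by (intro mult_left_mono sum_mono g_le sp) auto
          finally show "b < emp_objective loss \<xi> K \<omega> y" .
        qed
      qed
      with b(1) show "\<exists>b>a. \<forall>\<^sub>F K in sequentially. \<forall>x\<in>S. b < emp_objective loss \<xi> K \<omega> x" by blast
    qed
  qed
qed

text \<open>Convexity reduces the localisation of the minimisers of \<open>f\<close> to the behaviour of \<open>f\<close> on a
  sphere around \<open>x0\<close>, which is compact even when \<open>X\<close> is unbounded.\<close>

lemma convex_on_less_on_sphere_imp_dist_less:
  fixes f :: "'a::euclidean_space \<Rightarrow> real"
  assumes f: "convex_on X f" and x: "x0 \<in> X" "x \<in> X" "f x \<le> f x0" and r: "r > 0"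
    and sphere: "\<And>z. z \<in> X \<Longrightarrow> dist x0 z = r \<Longrightarrow> f x0 < f z"
  shows "dist x x0 < r"
proof (rule ccontr)
  assume "\<not> dist x x0 < r"
  then have n: "norm (x - x0) \<ge> r" by (simp add: dist_norm)
  \<comment> \<open>The parameter at which the segment from \<open>x0\<close> to \<open>x\<close>
    crosses the sphere of radius \<open>r\<close>.\<close>
  define u where "u = r / norm (x - x0)"
  have np: "norm (x - x0) > 0" using n r by linarith
  have u: "0 \<le> u" "u \<le> 1" using n r np by (auto simp: u_def)
  define z where "z = (1 - u) *\<^sub>R x0 + u *\<^sub>R x"
  have "x0 - z = u *\<^sub>R (x0 - x)" by (simp add: z_def algebra_simps)
  then have "dist x0 z = r" using np r by (simp add: dist_norm u_def norm_minus_commute)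
  moreover have "z \<in> X"
    unfolding z_def using convex_on_imp_convex[OF f] x u by (simp add: convex_alt)
  ultimately have "f x0 < f z" using sphere by blast
  also have "f z \<le> (1 - u) * f x0 + u * f x"
    unfolding z_def using u x by (intro convex_onD[OF f])
  also have "\<dots> \<le> (1 - u) * f x0 + u * f x0"
    using u x by (intro add_left_mono mult_left_mono) auto
  finally show False by (simp add: algebra_simps)
qed

section \<open>Almost sure convergence of optimal values and solutions\<close>

theorem theorem2:
  fixes M :: "'w measure"
    and \<Xi> :: "real set"
    and P :: "real measure"
    and \<xi> :: "nat \<Rightarrow> 'w \<Rightarrow> real"
    and X :: "(real ^ 'd) set"
    and loss :: "real ^ 'd \<Rightarrow> real \<Rightarrow> real"
    and L :: real
    and C :: "real \<Rightarrow> real"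
    and \<beta> :: "nat \<Rightarrow> real"
    and xhat :: "nat \<Rightarrow> 'w \<Rightarrow> real ^ 'd"
    and xstar :: "real ^ 'd"
  assumes "prob_space M"
    and "prob_space P" and "sets P = sets (restrict_space borel \<Xi>)"
    and "\<And>k. k \<ge> 1 \<Longrightarrow> \<xi> k \<in> measurable M P"
    and "(\<lambda>k. tv_dist (distr M P (\<xi> k)) P) \<longlonglongrightarrow> 0"
    and "summable (\<lambda>k. phi_mixing M P \<xi> (Suc k))"
    and "df_concentration M P \<xi> C"
    and "convex X"
    and "\<And>s. s \<in> \<Xi> \<Longrightarrow> closed_convex_proper_on X (\<lambda>x. loss x s)"
    and "\<And>x. x \<in> X \<Longrightarrow> loss x \<in> borel_measurable P"
    and "\<And>x s. x \<in> X \<Longrightarrow> s \<in> \<Xi> \<Longrightarrow> \<bar>loss x s\<bar> \<le> L"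
    and "\<And>K \<omega>. K \<ge> 1 \<Longrightarrow> \<omega> \<in> space M \<Longrightarrow>
           optimal_solution (emp_objective loss \<xi> K \<omega>) X (xhat K \<omega>)"
    and "optimal_solution (true_objective loss P) X xstar"
    and "\<And>x. optimal_solution (true_objective loss P) X x \<Longrightarrow> x = xstar"
    and "\<And>K. K \<ge> 1 \<Longrightarrow> 0 < \<beta> K \<and> \<beta> K < 1"
    and "(\<lambda>K. eps_radius M P \<xi> C K (\<beta> K)) \<longlonglongrightarrow> 0"
    and "summable (\<lambda>K. \<beta> (Suc K))"
  shows "(AE \<omega> in M. (\<lambda>K. optimal_value (emp_objective loss \<xi> K \<omega>) X)
                        \<longlonglongrightarrow> optimal_value (true_objective loss P) X)
       \<and> (AE \<omega> in M. (\<lambda>K. xhat K \<omega>) \<longlonglongrightarrow> xstar)"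
proof -
  interpret P: prob_space P by fact
  interpret mixing_samples M P \<xi>
    using assms(1,2,4,6) by (intro mixing_samples.intro mixing_samples_axioms.intro) auto
  have sp: "space P = \<Xi>"
    using sets_eq_imp_space_eq[OF assms(3)] by (simp add: space_restrict_space)
  have xs: "xstar \<in> X" "\<And>y. y \<in> X \<Longrightarrow> true_objective loss P xstar \<le> true_objective loss P y"
    using assms(13) by (auto simp: optimal_solution_iff)
  have unique: "true_objective loss P xstar < true_objective loss P y" if "y \<in> X" "y \<noteq> xstar" for y
    using that xs assms(14)[of y] unfolding optimal_solution_iff by (meson not_le order_trans)
  obtain s0 where s0: "s0 \<in> \<Xi>" using P.not_empty sp by blast
  have X: "closed X"
  proof (rule closed_epigraph_bounded_imp_closed)
    show "closed (epigraph X (\<lambda>x. loss x s0))"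
      using assms(9)[OF s0] by (simp add: closed_convex_proper_on_def)
    show "loss y s0 \<le> L" if "y \<in> X" for y
      using assms(11)[OF that s0] by simp
  qed
  have lim_star: "AE \<omega> in M. (\<lambda>K. empirical_mean (loss xstar) \<xi> K \<omega>) \<longlonglongrightarrow> (\<integral>s. loss xstar s \<partial>P)"
    using assms(10,11) xs(1) sp by (intro strong_law_bounded[where L = L]) auto
  have lower: "AE \<omega> in M. \<forall>S a. compact S \<longrightarrow> S \<subseteq> X \<longrightarrow> (\<forall>x\<in>S. a < true_objective loss P x) \<longrightarrow>
      (\<exists>b>a. \<forall>\<^sub>F K in sequentially. \<forall>x\<in>S. b < emp_objective loss \<xi> K \<omega> x)"
    using assms(9-11) sp
    by (intro emp_objective_eventually_greater_on_compact[where L = L]) auto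
  have "AE \<omega> in M. (\<lambda>K. optimal_value (emp_objective loss \<xi> K \<omega>) X)
          \<longlonglongrightarrow> optimal_value (true_objective loss P) X
      \<and> (\<lambda>K. xhat K \<omega>) \<longlonglongrightarrow> xstar"
    using AE_space lim_star lower
  proof eventually_elim
    case (elim \<omega>)
    \<comment> \<open>The outcome is now fixed, and the rest of the argument is
      deterministic.\<close>
    define F where "F K = emp_objective loss \<xi> K \<omega>" for K
    have opt: "optimal_solution (F K) X (xhat K \<omega>)" if "K \<ge> 1" for K
      unfolding F_def using that elim(1) by (rule assms(12))
    have conv: "convex_on X (F K)" for K
      unfolding F_def
    proof (rule convex_on_emp_objective[OF \<open>convex X\<close>])
      fix k :: nat assume "k \<ge> 1"
      then have "\<xi> k \<omega> \<in> \<Xi>" using measurable_space[OF assms(4) elim(1)] sp by blast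
      then show "convex_on X (\<lambda>x. loss x (\<xi> k \<omega>))"
        using assms(9) by (simp add: closed_convex_proper_on_def)
    qed
    have Fstar: "(\<lambda>K. F K xstar) \<longlonglongrightarrow> true_objective loss P xstar"
      using elim(2) by (simp add: F_def emp_objective_def true_objective_def)
    have xhat: "(\<lambda>K. xhat K \<omega>) \<longlonglongrightarrow> xstar"
    proof (rule tendstoI)
      fix r :: real assume r: "r > 0"
      have "compact (X \<inter> sphere xstar r)" using X by (intro closed_Int_compact) auto
      moreover have "\<forall>z\<in>X \<inter> sphere xstar r. true_objective loss P xstar < true_objective loss P z"
        using unique r by auto
      ultimately obtain b where b: "b > true_objective loss P xstar"
        "\<forall>\<^sub>F K in sequentially. \<forall>z\<in>X \<inter> sphere xstar r. b < F K z"
        using elim(3) unfolding F_def by (meson inf_le1)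
      \<comment> \<open>Eventually \<open>b\<close> separates the values of \<open>F K\<close> on
        the sphere from its value at \<open>xstar\<close>, which forces the minimiser
        inside.\<close>
      from b(2) order_tendstoD(2)[OF Fstar b(1)] eventually_ge_at_top[of 1]
      show "\<forall>\<^sub>F K in sequentially. dist (xhat K \<omega>) xstar < r"
      proof eventually_elim
        case (elim K)
        show ?case
        proof (rule convex_on_less_on_sphere_imp_dist_less[OF conv xs(1) _ _ r])
          show "xhat K \<omega> \<in> X" "F K (xhat K \<omega>) \<le> F K xstar"
            using opt elim(3) xs(1) by (auto simp: optimal_solution_iff)
          show "F K xstar < F K z" if "z \<in> X" "dist xstar z = r" for z
            using elim(2) bspec[OF elim(1), of z] that by simp
        qed
      qed
    qed
    have "(\<lambda>K. F K (xhat K \<omega>)) \<longlonglongrightarrow> true_objective loss P xstar"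
    proof (rule order_tendstoI)
      \<comment> \<open>The minimisers already converge, so they eventually lie in the unit ball
        around \<open>xstar\<close>. There the compact lower bound applies even if \<open>X\<close>
        is unbounded.\<close>
      fix a assume a: "a < true_objective loss P xstar"
      have "compact (X \<inter> cball xstar 1)" using X by (intro closed_Int_compact) auto
      moreover have "\<forall>z\<in>X \<inter> cball xstar 1. a < true_objective loss P z"
        using xs(2) a by (auto intro: order.strict_trans2)
      ultimately obtain b where b: "b > a"
        "\<forall>\<^sub>F K in sequentially. \<forall>z\<in>X \<inter> cball xstar 1. b < F K z"
        using elim(3) unfolding F_def by (meson inf_le1)
      from b(2) tendstoD[OF xhat zero_less_one] eventually_ge_at_top[of 1]
      show "\<forall>\<^sub>F K in sequentially. a < F K (xhat K \<omega>)"
      proof eventually_elim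
        case (elim K)
        then have "xhat K \<omega> \<in> X \<inter> cball xstar 1"
          using opt[of K] by (auto simp: optimal_solution_iff dist_commute)
        then show ?case using elim(1) b(1) by (meson order.strict_trans)
      qed
    next
      \<comment> \<open>From above it suffices to compare the minimiser with the competitor
        \<open>xstar\<close>.\<close>
      fix a assume "true_objective loss P xstar < a"
      from order_tendstoD(2)[OF Fstar this] eventually_ge_at_top[of 1]
      show "\<forall>\<^sub>F K in sequentially. F K (xhat K \<omega>) < a"
      proof eventually_elim
        case (elim K)
        then show ?case
          using opt[of K] xs(1) by (auto simp: optimal_solution_iff intro: order.strict_trans1)
      qed
    qed
    moreover have "\<forall>\<^sub>F K in sequentially. F K (xhat K \<omega>) = optimal_value (F K) X"
      using eventually_ge_at_top[of 1] by eventually_elim (simp add: optimal_value_eq[OF opt])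
    ultimately have "(\<lambda>K. optimal_value (F K) X) \<longlonglongrightarrow> true_objective loss P xstar"
      by (rule Lim_transform_eventually)
    then show ?case using xhat optimal_value_eq[OF assms(13)] by (simp add: F_def)
  qed
  then show ?thesis by (simp add: AE_conj_iff)
qed

end
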